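(* For any $\infty$-operad $O^{\otimes}$, composition with the multiplicative extensions $K^{\otimes}$ and $\mathbf{K}^{\otimes}$ induce functors $$K^{\otimes}\colon\mathbf{Alg}_{O^{\otimes}}(\mathbf{Wald}_{\infty}^{\otimes})\to\mathbf{Alg}_{O^{\otimes}}(\mathbf{Kan}^{\times})$$ and $$\mathbf{K}^{\otimes}\colon\mathbf{Alg}_{O^{\otimes}}(\mathbf{Wald}_{\infty}^{\otimes})\to\mathbf{Alg}_{O^{\otimes}}(\mathbf{Sp}^{\wedge}).$$
   Context: $\infty$-categories are quasicategories; $\mathbf{Kan}$ is the $\infty$-category of spaces with cartesian symmetric monoidal structure $\mathbf{Kan}^\times$, and $\mathbf{Sp}^\wedge$ is the $\infty$-category of spectra with smash product. $\mathbf{Alg}_{O^\otimes}(\mathcal{C}^\otimes)$ is the $\infty$-category of $O^\otimes$-algebras in $\mathcal{C}^\otimes$, i.e. morphisms of $\infty$-operads $O^\otimes\to\mathcal{C}^\otimes$. A pair of $\infty$-categories is an $\infty$-category with a subcategory containing all equivalences, whose morphisms are called ingressive (or cofibrations). A functor of pairs carries cofibrations to cofibrations; in a product of pairs, a morphism is ingressive iff each component is. A Waldhausen $\infty$-category is a pair with a zero object, in which every morphism from the zero object is ingressive, and pushouts of ingressive morphisms along arbitrary morphisms exist and are ingressive. An exact functor is a functor of pairs preserving zero objects and pushouts of ingressive morphisms (hence cofiber sequences). $\mathbf{Wald}_\infty$ is the $\infty$-category of Waldhausen $\infty$-categories and exact functors; it has direct sums $\oplus$ and a zero object. For a Waldhausen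 $\infty$-category $C$, $E(C)$ is the Waldhausen $\infty$-category of cofiber sequences $X\rightarrowtail Y\to Y/X$ in $C$ (ingressive morphisms being those with all three components ingressive), with exact functors $m\colon E(C)\to C$, $[X\rightarrowtail Y\to Y/X]\mapsto Y$; $i\colon C\oplus C\to E(C)$, $(X,Z)\mapsto[X\rightarrowtail X\vee Z\to Z]$; $r\colon E(C)\to C\oplus C$, $[X\rightarrowtail Y\to Y/X]\mapsto(X,Y/X)$. A ($\mathbf{Kan}$-valued) theory is a functor $\phi\colon\mathbf{Wald}_\infty\to\mathbf{Kan}$ preserving filtered colimits with $\phi(0)$ terminal. It is additive if $r$ induces equivalences $\phi(E(C))\simeq\phi(C)\times\phi(C)$ and the multiplication $\phi(m\circ i)\colon\phi(C)\times\phi(C)\simeq\phi(E(C))\to\phi(C)$ is grouplike. The inclusion of additive theories into theories has a left adjoint $D$. The theory $\iota$ sends $C$ to its maximal Kan subcomplex, and algebraic $K$-theory is $K=D\iota$; equivalently $K(C)\simeq\Omega|\iota S_\bullet(C)|$. Its canonical lift to connective spectra is the connective algebraic $K$-theory functor $\mathbf{K}\colon\mathbf{Wald}_\infty\to\mathbf{Sp}$, with $\Omega^\infty\mathbf{K}\simeq K$. $\Lambda(\mathbf{F})$ is the category of finite sets in which a morphism $J\to I$ is a map $J\to I_+=I\sqcup\{+\}$ (equivalent to pointed finite sets); $J_i$ denotes the preimage of $i\in I$. $\mathbf{Wald}_\infty^\otimes\to N\Lambda(\mathbf{F})$ is the symmetric monoidal $\infty$-category with objects $(I,(C_i)_{i\in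 I})$, each $C_i$ a Waldhausen $\infty$-category, and morphisms $(J,(D_j))\to(I,(C_i))$ consisting of a morphism $J\to I$ of $\Lambda(\mathbf{F})$ and functors of pairs $\prod_{j\in J_i}D_j\to C_i$ that are exact separately in each variable (when objects in the other variables are fixed). A multiplicative theory is a morphism of $\infty$-operads $\phi^\otimes\colon\mathbf{Wald}_\infty^\otimes\to\mathbf{Kan}^\times$ whose underlying functor $\phi$ is a theory; it is then said to extend $\phi$. The inclusion of the full subcategory of multiplicative theories with additive underlying theory into that of all multiplicative theories has a left adjoint $D^\otimes$ covering $D$. The multiplicative theory $\iota^\otimes$ extending $\iota$ is the composite $\mathbf{Wald}_\infty^\otimes\hookrightarrow\mathbf{Pair}_\infty^\times\to\mathbf{Cat}_\infty^\times\to\mathbf{Kan}^\times$, where $\mathbf{Pair}_\infty$ is the $\infty$-category of pairs, the second functor is forgetful, and the third is induced by the right adjoint of the inclusion $\mathbf{Kan}\subset\mathbf{Cat}_\infty$. $K^\otimes=D^\otimes\iota^\otimes\colon\mathbf{Wald}_\infty^\otimes\to\mathbf{Kan}^\times$ is the canonical multiplicative extension of $K$, and $\mathbf{K}^\otimes\colon\mathbf{Wald}_\infty^\otimes\to\mathbf{Sp}^\wedge$ is the corresponding canonical morphism of $\infty$-operads extending $\mathbf{K}$. *)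

theory Defs
  imports "HOL-Library.FuncSet" "HOL-Library.Equipollence" "HOL-Algebra.Group"
begin

section \<open>Simplicial sets\<close>

text \<open>
  A monotone map from \<open>[m]\<close> to \<open>[n]\<close> is the sorted list of its \<open>m + 1\<close> values, so that the
  composite of \<open>\<alpha>\<close> after \<open>\<beta>\<close> is \<open>map ((!) \<alpha>) \<beta>\<close>.  For such an \<open>\<alpha>\<close>, the map \<open>act X n \<alpha>\<close> is the
  structure map from \<open>n\<close>-simplices to \<open>m\<close>-simplices; in particular \<open>act X n [i]\<close> is the \<open>i\<close>-th vertex
  and \<open>act X n [i, j]\<close> is the edge from the \<open>i\<close>-th to the \<open>j\<close>-th vertex.
\<close>

definition mono_maps :: "nat \<Rightarrow> nat \<Rightarrow> nat list set" where
  "mono_maps m n = {\<alpha>. length \<alpha> = Suc m \<and> sorted \<alpha> \<and> set \<alpha> \<subseteq> {..n}}"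

record 'a sset =
  cells :: "nat \<Rightarrow> 'a set"
  act :: "nat \<Rightarrow> nat list \<Rightarrow> 'a \<Rightarrow> 'a"

definition is_sset :: "'a sset \<Rightarrow> bool" where
  "is_sset X \<longleftrightarrow>
     (\<forall>m n. \<forall>\<alpha>\<in>mono_maps m n. \<forall>x\<in>cells X n. act X n \<alpha> x \<in> cells X m) \<and>
     (\<forall>n. \<forall>x\<in>cells X n. act X n [0..<Suc n] x = x) \<and>
     (\<forall>k m n. \<forall>\<alpha>\<in>mono_maps m n. \<forall>\<beta>\<in>mono_maps k m. \<forall>x\<in>cells X n.
        act X m \<beta> (act X n \<alpha> x) = act X n (map ((!) \<alpha>) \<beta>) x)"

text \<open>
  Simplicial maps are extensional (equal to \<open>undefined\<close> off the simplices of their source), so that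
  equality of maps is equality of functions.
\<close>

definition smap :: "'a sset \<Rightarrow> 'b sset \<Rightarrow> (nat \<Rightarrow> 'a \<Rightarrow> 'b) set" where
  "smap X Y = {f. (\<forall>n. f n \<in> cells X n \<rightarrow>\<^sub>E cells Y n) \<and>
     (\<forall>m n. \<forall>\<alpha>\<in>mono_maps m n. \<forall>x\<in>cells X n. f m (act X n \<alpha> x) = act Y n \<alpha> (f n x))}"

definition smap_comp ::
  "'a sset \<Rightarrow> (nat \<Rightarrow> 'b \<Rightarrow> 'c) \<Rightarrow> (nat \<Rightarrow> 'a \<Rightarrow> 'b) \<Rightarrow> nat \<Rightarrow> 'a \<Rightarrow> 'c" where
  "smap_comp X g f = (\<lambda>n. \<lambda>x\<in>cells X n. g n (f n x))"

definition smap_id :: "'a sset \<Rightarrow> nat \<Rightarrow> 'a \<Rightarrow> 'a" where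
  "smap_id X = (\<lambda>n. \<lambda>x\<in>cells X n. x)"

definition smap_restrict :: "'a sset \<Rightarrow> (nat \<Rightarrow> 'a \<Rightarrow> 'b) \<Rightarrow> nat \<Rightarrow> 'a \<Rightarrow> 'b" where
  "smap_restrict X f = (\<lambda>n. restrict (f n) (cells X n))"

definition src :: "'a sset \<Rightarrow> 'a \<Rightarrow> 'a" where "src X f = act X 1 [0] f"
definition tgt :: "'a sset \<Rightarrow> 'a \<Rightarrow> 'a" where "tgt X f = act X 1 [1] f"

text \<open>\<open>degen X n x\<close> is the totally degenerate \<open>n\<close>-simplex on the vertex \<open>x\<close>.\<close>

definition degen :: "'a sset \<Rightarrow> nat \<Rightarrow> 'a \<Rightarrow> 'a" where
  "degen X n x = act X 0 (replicate (Suc n) 0) x"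

definition sub_sset :: "'a sset \<Rightarrow> (nat \<Rightarrow> 'a \<Rightarrow> bool) \<Rightarrow> 'a sset" where
  "sub_sset X P = X\<lparr>cells := \<lambda>n. {x \<in> cells X n. P n x}\<rparr>"

definition full_on :: "'a sset \<Rightarrow> ('a \<Rightarrow> bool) \<Rightarrow> 'a sset" where
  "full_on X P = sub_sset X (\<lambda>n x. \<forall>i\<le>n. P (act X n [i] x))"

definition simplex :: "nat \<Rightarrow> nat list sset" where
  "simplex n = \<lparr>cells = \<lambda>m. mono_maps m n, act = \<lambda>_ \<alpha> \<beta>. map ((!) \<beta>) \<alpha>\<rparr>"

definition horn :: "nat \<Rightarrow> nat \<Rightarrow> nat list sset" where
  "horn n k = sub_sset (simplex n) (\<lambda>_ \<beta>. \<not> {..n} - {k} \<subseteq> set \<beta>)"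

definition bdry :: "nat \<Rightarrow> nat list sset" where
  "bdry n = sub_sset (simplex n) (\<lambda>_ \<beta>. set \<beta> \<noteq> {..n})"

definition sprod :: "'a sset \<Rightarrow> 'b sset \<Rightarrow> ('a \<times> 'b) sset" where
  "sprod X Y = \<lparr>cells = \<lambda>n. cells X n \<times> cells Y n,
     act = \<lambda>n \<alpha> z. (act X n \<alpha> (fst z), act Y n \<alpha> (snd z))\<rparr>"

definition sprod_fam :: "'i set \<Rightarrow> ('i \<Rightarrow> 'a sset) \<Rightarrow> ('i \<Rightarrow> 'a) sset" where
  "sprod_fam A D = \<lparr>cells = \<lambda>n. PiE A (\<lambda>j. cells (D j) n),
     act = \<lambda>n \<alpha> x. \<lambda>j\<in>A. act (D j) n \<alpha> (x j)\<rparr>"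

definition sfun :: "'a sset \<Rightarrow> 'b sset \<Rightarrow> (nat \<Rightarrow> nat list \<times> 'a \<Rightarrow> 'b) sset" where
  "sfun X Y = \<lparr>cells = \<lambda>n. smap (sprod (simplex n) X) Y,
     act = \<lambda>n \<alpha> \<sigma> k. \<lambda>z\<in>cells (sprod (simplex (length \<alpha> - 1)) X) k.
             \<sigma> k (map ((!) \<alpha>) (fst z), snd z)\<rparr>"

text \<open>Vertices of \<open>sfun X Y\<close> are maps out of \<open>\<Delta>\<^sup>0 \<times> X\<close>; the next two operations identify them with maps out
  of \<open>X\<close>.\<close>

definition of_vertex :: "'a sset \<Rightarrow> (nat \<Rightarrow> nat list \<times> 'a \<Rightarrow> 'b) \<Rightarrow> nat \<Rightarrow> 'a \<Rightarrow> 'b" where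
  "of_vertex X \<sigma> = (\<lambda>n. \<lambda>x\<in>cells X n. \<sigma> n (replicate (Suc n) 0, x))"

definition to_vertex :: "'a sset \<Rightarrow> (nat \<Rightarrow> 'a \<Rightarrow> 'b) \<Rightarrow> nat \<Rightarrow> nat list \<times> 'a \<Rightarrow> 'b" where
  "to_vertex X f = (\<lambda>n. \<lambda>z\<in>cells (sprod (simplex 0) X) n. f n (snd z))"

text \<open>Evaluation at a vertex \<open>v\<close> of \<open>X\<close>, as a map from \<open>sfun X Y\<close> to \<open>Y\<close>.\<close>

definition eval_at :: "'a sset \<Rightarrow> 'a \<Rightarrow> nat \<Rightarrow> (nat \<Rightarrow> nat list \<times> 'a \<Rightarrow> 'b) \<Rightarrow> 'b" where
  "eval_at X v n \<sigma> = \<sigma> n ([0..<Suc n], degen X n v)"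

section \<open>Quasicategories\<close>

definition fills :: "nat list sset \<Rightarrow> 'a sset \<Rightarrow> nat \<Rightarrow> (nat \<Rightarrow> nat list \<Rightarrow> 'a) \<Rightarrow> 'a \<Rightarrow> bool" where
  "fills A X n f \<sigma> \<longleftrightarrow> \<sigma> \<in> cells X n \<and> (\<forall>m. \<forall>\<alpha>\<in>cells A m. f m \<alpha> = act X n \<alpha> \<sigma>)"

definition quasicat :: "'a sset \<Rightarrow> bool" where
  "quasicat X \<longleftrightarrow> is_sset X \<and>
     (\<forall>n k. 0 < k \<and> k < n \<longrightarrow> (\<forall>f\<in>smap (horn n k) X. \<exists>\<sigma>. fills (horn n k) X n f \<sigma>))"

definition kan :: "'a sset \<Rightarrow> bool" where
  "kan X \<longleftrightarrow> is_sset X \<and>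
     (\<forall>n k. 0 < n \<and> k \<le> n \<longrightarrow> (\<forall>f\<in>smap (horn n k) X. \<exists>\<sigma>. fills (horn n k) X n f \<sigma>))"

definition is_equiv :: "'a sset \<Rightarrow> 'a \<Rightarrow> bool" where
  "is_equiv X f \<longleftrightarrow> f \<in> cells X 1 \<and>
     (\<exists>s\<in>cells X 2. \<exists>t\<in>cells X 2.
        act X 2 [0, 1] s = f \<and> act X 2 [0, 2] s = degen X 1 (src X f) \<and>
        act X 2 [1, 2] t = f \<and> act X 2 [0, 2] t = degen X 1 (tgt X f) \<and>
        act X 2 [1, 2] s = act X 2 [0, 1] t)"

text \<open>The maximal Kan subcomplex.\<close>

definition core :: "'a sset \<Rightarrow> 'a sset" where
  "core X = sub_sset X (\<lambda>n x. \<forall>i j. i \<le> j \<and> j \<le> n \<longrightarrow> is_equiv X (act X n [i, j] x))"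

definition nat_equiv ::
  "'a sset \<Rightarrow> 'b sset \<Rightarrow> (nat \<Rightarrow> 'a \<Rightarrow> 'b) \<Rightarrow> (nat \<Rightarrow> 'a \<Rightarrow> 'b) \<Rightarrow> bool" where
  "nat_equiv X Y f g \<longleftrightarrow> f \<in> smap X Y \<and> g \<in> smap X Y \<and>
     (\<exists>h. is_equiv (sfun X Y) h \<and> src (sfun X Y) h = to_vertex X f \<and> tgt (sfun X Y) h = to_vertex X g)"

text \<open>Equivalences of quasicategories; between Kan complexes these are the homotopy equivalences.\<close>

definition is_equivalence :: "'a sset \<Rightarrow> 'b sset \<Rightarrow> (nat \<Rightarrow> 'a \<Rightarrow> 'b) \<Rightarrow> bool" where
  "is_equivalence X Y f \<longleftrightarrow> f \<in> smap X Y \<and>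
     (\<exists>g\<in>smap Y X. nat_equiv X X (smap_comp X g f) (smap_id X) \<and>
                    nat_equiv Y Y (smap_comp Y f g) (smap_id Y))"

definition contractible :: "'a sset \<Rightarrow> bool" where
  "contractible X \<longleftrightarrow> is_equivalence X (simplex 0) (\<lambda>n. \<lambda>x\<in>cells X n. replicate (Suc n) 0)"

text \<open>The mapping space \<open>{x} \<times> Fun(\<Delta>\<^sup>1, X) \<times> {y}\<close>, the products being fibre products over \<open>X\<close>.\<close>

definition map_space :: "'a sset \<Rightarrow> 'a \<Rightarrow> 'a \<Rightarrow> (nat \<Rightarrow> nat list \<times> nat list \<Rightarrow> 'a) sset" where
  "map_space X x y = sub_sset (sfun (simplex 1) X) (\<lambda>k \<sigma>. \<forall>m. \<forall>t\<in>mono_maps m k.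
      \<sigma> m (t, replicate (Suc m) 0) = degen X m x \<and> \<sigma> m (t, replicate (Suc m) 1) = degen X m y)"

definition initial :: "'a sset \<Rightarrow> 'a \<Rightarrow> bool" where
  "initial X x \<longleftrightarrow> x \<in> cells X 0 \<and>
     (\<forall>n\<ge>1. \<forall>f\<in>smap (bdry n) X. f 0 [0] = x \<longrightarrow> (\<exists>\<sigma>. fills (bdry n) X n f \<sigma>))"

definition terminal :: "'a sset \<Rightarrow> 'a \<Rightarrow> bool" where
  "terminal X x \<longleftrightarrow> x \<in> cells X 0 \<and>
     (\<forall>n\<ge>1. \<forall>f\<in>smap (bdry n) X. f 0 [n] = x \<longrightarrow> (\<exists>\<sigma>. fills (bdry n) X n f \<sigma>))"

definition zero_object :: "'a sset \<Rightarrow> 'a \<Rightarrow> bool" where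
  "zero_object X x \<longleftrightarrow> initial X x \<and> terminal X x"

subsection \<open>Joins, slices, limits and colimits\<close>

text \<open>An \<open>n\<close>-simplex of the join is an \<open>n\<close>-simplex of \<open>X\<close>, or one of \<open>Y\<close>, or \<open>JB i x y\<close> with \<open>x\<close> an
  \<open>i\<close>-simplex of \<open>X\<close> and \<open>y\<close> an \<open>(n - i - 1)\<close>-simplex of \<open>Y\<close>.\<close>

datatype ('a, 'b) jcell = JL 'a | JR 'b | JB nat 'a 'b

definition join_act ::
  "'a sset \<Rightarrow> 'b sset \<Rightarrow> nat \<Rightarrow> nat list \<Rightarrow> ('a, 'b) jcell \<Rightarrow> ('a, 'b) jcell" where
  "join_act X Y n \<alpha> z = (case z of
      JL x \<Rightarrow> JL (act X n \<alpha> x)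
    | JR y \<Rightarrow> JR (act Y n \<alpha> y)
    | JB i x y \<Rightarrow>
        (let l = filter (\<lambda>a. a \<le> i) \<alpha>; r = map (\<lambda>a. a - Suc i) (filter (\<lambda>a. i < a) \<alpha>)
         in if r = [] then JL (act X i l x)
            else if l = [] then JR (act Y (n - Suc i) r y)
            else JB (length l - 1) (act X i l x) (act Y (n - Suc i) r y)))"

definition join :: "'a sset \<Rightarrow> 'b sset \<Rightarrow> ('a, 'b) jcell sset" where
  "join X Y = \<lparr>cells = \<lambda>n. JL ` cells X n \<union> JR ` cells Y n \<union>
       {JB i x y | i x y. i < n \<and> x \<in> cells X i \<and> y \<in> cells Y (n - Suc i)},
     act = join_act X Y\<rparr>"

text \<open>For a diagram \<open>p\<close> of shape \<open>K\<close> in \<open>C\<close>, the slices \<open>C\<^bsub>p/\<^esub>\<close> and \<open>C\<^bsub>/p\<^esub>\<close>.\<close>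

definition under_slice ::
  "'a sset \<Rightarrow> 'k sset \<Rightarrow> (nat \<Rightarrow> 'k \<Rightarrow> 'a) \<Rightarrow> (nat \<Rightarrow> ('k, nat list) jcell \<Rightarrow> 'a) sset" where
  "under_slice C K p =
     \<lparr>cells = \<lambda>n. {f \<in> smap (join K (simplex n)) C. \<forall>m. \<forall>x\<in>cells K m. f m (JL x) = p m x},
      act = \<lambda>n \<alpha> f k. \<lambda>z\<in>cells (join K (simplex (length \<alpha> - 1))) k.
              f k (map_jcell id (map ((!) \<alpha>)) z)\<rparr>"

definition over_slice ::
  "'a sset \<Rightarrow> 'k sset \<Rightarrow> (nat \<Rightarrow> 'k \<Rightarrow> 'a) \<Rightarrow> (nat \<Rightarrow> (nat list, 'k) jcell \<Rightarrow> 'a) sset" where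
  "over_slice C K p =
     \<lparr>cells = \<lambda>n. {f \<in> smap (join (simplex n) K) C. \<forall>m. \<forall>x\<in>cells K m. f m (JR x) = p m x},
      act = \<lambda>n \<alpha> f k. \<lambda>z\<in>cells (join (simplex (length \<alpha> - 1)) K) k.
              f k (map_jcell (map ((!) \<alpha>)) id z)\<rparr>"

definition colimit_cocone ::
  "'a sset \<Rightarrow> 'k sset \<Rightarrow> (nat \<Rightarrow> ('k, nat list) jcell \<Rightarrow> 'a) \<Rightarrow> bool" where
  "colimit_cocone C K f \<longleftrightarrow> initial (under_slice C K (\<lambda>n. \<lambda>x\<in>cells K n. f n (JL x))) f"

definition limit_cone ::
  "'a sset \<Rightarrow> 'k sset \<Rightarrow> (nat \<Rightarrow> (nat list, 'k) jcell \<Rightarrow> 'a) \<Rightarrow> bool" where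
  "limit_cone C K f \<longleftrightarrow> terminal (over_slice C K (\<lambda>n. \<lambda>x\<in>cells K n. f n (JR x))) f"

text \<open>
  Squares have shape \<open>\<Delta>\<^sup>1 \<times> \<Delta>\<^sup>1\<close>.  It is the cocone on the horn \<open>horn 2 0\<close>, whose vertices \<open>0\<close>, \<open>1\<close>, \<open>2\<close> become
  \<open>(0,0)\<close>, \<open>(0,1)\<close>, \<open>(1,0)\<close>, and also the cone on \<open>horn 2 2\<close>, whose vertices become \<open>(0,1)\<close>, \<open>(1,0)\<close>, \<open>(1,1)\<close>.
\<close>

definition square :: "(nat list \<times> nat list) sset" where
  "square = sprod (simplex 1) (simplex 1)"

fun po_cell :: "(nat list, nat list) jcell \<Rightarrow> nat list \<times> nat list" where
  "po_cell (JL l) = (map ((!) [0, 0, 1]) l, map ((!) [0, 1, 0]) l)"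
| "po_cell (JR r) = (map (\<lambda>_. 1) r, map (\<lambda>_. 1) r)"
| "po_cell (JB i l r) =
     (map ((!) [0, 0, 1]) l @ map (\<lambda>_. 1) r, map ((!) [0, 1, 0]) l @ map (\<lambda>_. 1) r)"

fun pb_cell :: "(nat list, nat list) jcell \<Rightarrow> nat list \<times> nat list" where
  "pb_cell (JL l) = (map (\<lambda>_. 0) l, map (\<lambda>_. 0) l)"
| "pb_cell (JR r) = (map ((!) [0, 1, 1]) r, map ((!) [1, 0, 1]) r)"
| "pb_cell (JB i l r) =
     (map (\<lambda>_. 0) l @ map ((!) [0, 1, 1]) r, map (\<lambda>_. 0) l @ map ((!) [1, 0, 1]) r)"

definition pushout_square :: "'a sset \<Rightarrow> (nat \<Rightarrow> nat list \<times> nat list \<Rightarrow> 'a) \<Rightarrow> bool" where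
  "pushout_square C q \<longleftrightarrow> q \<in> smap square C \<and>
     colimit_cocone C (horn 2 0) (\<lambda>n. \<lambda>z\<in>cells (join (horn 2 0) (simplex 0)) n. q n (po_cell z))"

definition pullback_square :: "'a sset \<Rightarrow> (nat \<Rightarrow> nat list \<times> nat list \<Rightarrow> 'a) \<Rightarrow> bool" where
  "pullback_square C q \<longleftrightarrow> q \<in> smap square C \<and>
     limit_cone C (horn 2 2) (\<lambda>n. \<lambda>z\<in>cells (join (simplex 0) (horn 2 2)) n. q n (pb_cell z))"

definition sq_top :: "(nat \<Rightarrow> nat list \<times> nat list \<Rightarrow> 'a) \<Rightarrow> 'a" where
  "sq_top q = q 1 ([0, 0], [0, 1])"
definition sq_left :: "(nat \<Rightarrow> nat list \<times> nat list \<Rightarrow> 'a) \<Rightarrow> 'a" where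
  "sq_left q = q 1 ([0, 1], [0, 0])"
definition sq_bottom :: "(nat \<Rightarrow> nat list \<times> nat list \<Rightarrow> 'a) \<Rightarrow> 'a" where
  "sq_bottom q = q 1 ([1, 1], [0, 1])"

definition finite_sset :: "'a sset \<Rightarrow> bool" where
  "finite_sset K \<longleftrightarrow> is_sset K \<and> (\<forall>n. finite (cells K n)) \<and>
     (\<exists>N. \<forall>n>N. \<forall>x\<in>cells K n. \<exists>m<n. \<exists>\<alpha>\<in>mono_maps n m. \<exists>y\<in>cells K m. x = act K m \<alpha> y)"

text \<open>
  The type \<open>'u\<close> plays the role of the universe: small means having fewer simplices in each degree than
  \<open>'u\<close> has elements.  The intended \<open>'u\<close> are those whose cardinality is strongly inaccessible.
\<close>

definition small :: "'u sset \<Rightarrow> bool" where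
  "small X \<longleftrightarrow> (\<forall>n. cells X n \<prec> (UNIV :: 'u set))"

text \<open>Every finite simplicial set has a copy with simplices in \<open>nat\<close>.\<close>

definition filtered :: "'a sset \<Rightarrow> bool" where
  "filtered J \<longleftrightarrow> quasicat J \<and>
     (\<forall>K :: nat sset. finite_sset K \<longrightarrow>
        (\<forall>f\<in>smap K J. \<exists>g\<in>smap (join K (simplex 0)) J. \<forall>n. \<forall>x\<in>cells K n. g n (JL x) = f n x))"

text \<open>The slice under an object, and localizations: \<open>\<eta>\<close> is an edge of \<open>X\<close> exhibiting its target as a
  localization of \<open>x\<close> with respect to the full subcategory on \<open>P\<close>, i.e. as the value at \<open>x\<close> of a left
  adjoint to the inclusion of that subcategory, with unit \<open>\<eta>\<close>.\<close>

definition under_object :: "'a sset \<Rightarrow> 'a \<Rightarrow> 'a sset" where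
  "under_object X x = \<lparr>cells = \<lambda>n. {\<sigma> \<in> cells X (Suc n). act X (Suc n) [0] \<sigma> = x},
     act = \<lambda>n \<alpha> \<sigma>. act X (Suc n) (0 # map Suc \<alpha>) \<sigma>\<rparr>"

definition localization_unit :: "'a sset \<Rightarrow> ('a \<Rightarrow> bool) \<Rightarrow> 'a \<Rightarrow> 'a \<Rightarrow> bool" where
  "localization_unit X P x \<eta> \<longleftrightarrow> initial (full_on (under_object X x) (\<lambda>e. P (tgt X e))) \<eta>"

section \<open>Simplicial categories and their homotopy coherent nerves\<close>

text \<open>In \<open>cmp \<C> k x y z g f\<close> the \<open>k\<close>-simplex \<open>f\<close> of maps from \<open>x\<close> to \<open>y\<close> is applied first.\<close>

record ('o, 'm) scat =
  objs :: "'o set"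
  maps :: "'o \<Rightarrow> 'o \<Rightarrow> 'm sset"
  cmp :: "nat \<Rightarrow> 'o \<Rightarrow> 'o \<Rightarrow> 'o \<Rightarrow> 'm \<Rightarrow> 'm \<Rightarrow> 'm"
  idn :: "'o \<Rightarrow> 'm"

text \<open>The nerve of the poset of subsets of \<open>{i..j}\<close> that contain both \<open>i\<close> and \<open>j\<close>.\<close>

definition paths :: "nat \<Rightarrow> nat \<Rightarrow> nat set list sset" where
  "paths i j = \<lparr>cells = \<lambda>k. {c. length c = Suc k \<and> sorted_wrt (\<subseteq>) c \<and>
                                 (\<forall>S\<in>set c. {i, j} \<subseteq> S \<and> S \<subseteq> {i..j})},
     act = \<lambda>_ \<alpha> c. map ((!) c) \<alpha>\<rparr>"

definition pairs_le :: "nat \<Rightarrow> (nat \<times> nat) set" where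
  "pairs_le n = {(i, j). i \<le> j \<and> j \<le> n}"

type_synonym ('o, 'm) ncell = "(nat \<Rightarrow> 'o) \<times> (nat \<times> nat \<Rightarrow> nat \<Rightarrow> nat set list \<Rightarrow> 'm)"

text \<open>An \<open>n\<close>-simplex is a simplicial functor from the rigidification of \<open>\<Delta>\<^sup>n\<close>.\<close>

definition coherent_nerve :: "('o, 'm) scat \<Rightarrow> ('o, 'm) ncell sset" where
  "coherent_nerve \<C> = \<lparr>cells = \<lambda>n. {(x, \<phi>).
       x \<in> {..n} \<rightarrow>\<^sub>E objs \<C> \<and>
       \<phi> \<in> PiE (pairs_le n) (\<lambda>(i, j). smap (paths i j) (maps \<C> (x i) (x j))) \<and>
       (\<forall>i\<le>n. \<phi> (i, i) 0 [{i}] = idn \<C> (x i)) \<and>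
       (\<forall>i j l k. i \<le> j \<and> j \<le> l \<and> l \<le> n \<longrightarrow>
          (\<forall>c\<in>cells (paths i j) k. \<forall>d\<in>cells (paths j l) k.
             \<phi> (i, l) k (map2 (\<union>) c d) =
             cmp \<C> k (x i) (x j) (x l) (\<phi> (j, l) k d) (\<phi> (i, j) k c)))},
     act = \<lambda>n \<alpha> (x, \<phi>). let m = length \<alpha> - 1 in
       (\<lambda>i\<in>{..m}. x (\<alpha> ! i),
        \<lambda>(i, j)\<in>pairs_le m. \<lambda>k. \<lambda>c\<in>cells (paths i j) k.
           \<phi> (\<alpha> ! i, \<alpha> ! j) k (map ((`) ((!) \<alpha>)) c))\<rparr>"

text \<open>The edge of the nerve given by a vertex \<open>g\<close> of \<open>maps \<C> x y\<close>.\<close>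

definition nerve_edge :: "('o, 'm) scat \<Rightarrow> 'o \<Rightarrow> 'o \<Rightarrow> 'm \<Rightarrow> ('o, 'm) ncell" where
  "nerve_edge \<C> x y g =
     (\<lambda>i\<in>{..1}. if i = 0 then x else y,
      \<lambda>(i, j)\<in>pairs_le 1. \<lambda>k. \<lambda>c\<in>cells (paths i j) k.
        if i < j then degen (maps \<C> x y) k g
        else if i = 0 then degen (maps \<C> x x) k (idn \<C> x)
        else degen (maps \<C> y y) k (idn \<C> y))"

section \<open>Infinity-operads\<close>

text \<open>
  Morphisms from \<open>J\<close> to \<open>I\<close> in \<open>\<Lambda>(F)\<close> are partial maps, \<open>None\<close> being the added point \<open>+\<close>.  As objects we
  take the finite sets of natural numbers, with \<open>{0}\<close> as the chosen one-element set.
\<close>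

definition fmaps :: "nat set \<Rightarrow> nat set \<Rightarrow> (nat \<rightharpoonup> nat) set" where
  "fmaps J I = {f. dom f \<subseteq> J \<and> ran f \<subseteq> I}"

definition fib :: "(nat \<rightharpoonup> nat) \<Rightarrow> nat \<Rightarrow> nat set" where
  "fib f i = {j. f j = Some i}"

definition pid :: "nat set \<Rightarrow> nat \<rightharpoonup> nat" where
  "pid I = Some |` I"

definition inert_map :: "nat set \<Rightarrow> nat set \<Rightarrow> (nat \<rightharpoonup> nat) \<Rightarrow> bool" where
  "inert_map J I f \<longleftrightarrow> f \<in> fmaps J I \<and> (\<forall>i\<in>I. \<exists>!j. f j = Some i)"

type_synonym lcell = "(nat \<Rightarrow> nat set) \<times> (nat \<times> nat \<Rightarrow> nat \<rightharpoonup> nat)"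

definition LF :: "lcell sset" where
  "LF = \<lparr>cells = \<lambda>n. {(I, f).
       I \<in> {..n} \<rightarrow>\<^sub>E {A. finite A} \<and>
       f \<in> PiE (pairs_le n) (\<lambda>(i, j). fmaps (I i) (I j)) \<and>
       (\<forall>i\<le>n. f (i, i) = pid (I i)) \<and>
       (\<forall>i j l. i \<le> j \<and> j \<le> l \<and> l \<le> n \<longrightarrow> f (i, l) = f (j, l) \<circ>\<^sub>m f (i, j))},
     act = \<lambda>n \<alpha> (I, f). let m = length \<alpha> - 1 in
       (\<lambda>i\<in>{..m}. I (\<alpha> ! i), \<lambda>(i, j)\<in>pairs_le m. f (\<alpha> ! i, \<alpha> ! j))\<rparr>"

definition LF_object :: "nat set \<Rightarrow> lcell" where
  "LF_object I = (\<lambda>i\<in>{..0}. I, \<lambda>(i, j)\<in>pairs_le 0. pid I)"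

definition LF_edge :: "nat set \<Rightarrow> nat set \<Rightarrow> (nat \<rightharpoonup> nat) \<Rightarrow> lcell" where
  "LF_edge J I f = (\<lambda>i\<in>{..1}. if i = 0 then J else I,
     \<lambda>(i, j)\<in>pairs_le 1. if i < j then f else if i = 0 then pid J else pid I)"

record 'a over_LF =
  tot :: "'a sset"
  prj :: "nat \<Rightarrow> 'a \<Rightarrow> lcell"

definition inner_fibration :: "'a over_LF \<Rightarrow> bool" where
  "inner_fibration P \<longleftrightarrow> is_sset (tot P) \<and> prj P \<in> smap (tot P) LF \<and>
     (\<forall>n k. 0 < k \<and> k < n \<longrightarrow> (\<forall>f\<in>smap (horn n k) (tot P). \<forall>\<tau>.
        fills (horn n k) LF n (smap_comp (horn n k) (prj P) f) \<tau> \<longrightarrow>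
        (\<exists>\<sigma>. fills (horn n k) (tot P) n f \<sigma> \<and> prj P n \<sigma> = \<tau>)))"

definition cocartesian :: "'a over_LF \<Rightarrow> 'a \<Rightarrow> bool" where
  "cocartesian P e \<longleftrightarrow> e \<in> cells (tot P) 1 \<and>
     (\<forall>n\<ge>2. \<forall>f\<in>smap (horn n 0) (tot P). f 1 [0, 1] = e \<longrightarrow> (\<forall>\<tau>.
        fills (horn n 0) LF n (smap_comp (horn n 0) (prj P) f) \<tau> \<longrightarrow>
        (\<exists>\<sigma>. fills (horn n 0) (tot P) n f \<sigma> \<and> prj P n \<sigma> = \<tau>)))"

definition over :: "'a over_LF \<Rightarrow> nat set \<Rightarrow> 'a \<Rightarrow> bool" where
  "over P I x \<longleftrightarrow> x \<in> cells (tot P) 0 \<and> prj P 0 x = LF_object I"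

definition cocartesian_over ::
  "'a over_LF \<Rightarrow> nat set \<Rightarrow> nat set \<Rightarrow> (nat \<rightharpoonup> nat) \<Rightarrow> 'a \<Rightarrow> 'a \<Rightarrow> 'a \<Rightarrow> bool" where
  "cocartesian_over P J I f x y e \<longleftrightarrow> cocartesian P e \<and> prj P 1 e = LF_edge J I f \<and>
     src (tot P) e = x \<and> tgt (tot P) e = y"

text \<open>The part of the mapping space from \<open>x\<close> (over \<open>J\<close>) to \<open>y\<close> (over \<open>I\<close>) that lies over \<open>f\<close>.\<close>

definition map_space_over ::
  "'a over_LF \<Rightarrow> nat set \<Rightarrow> nat set \<Rightarrow> (nat \<rightharpoonup> nat) \<Rightarrow> 'a \<Rightarrow> 'a \<Rightarrow>
   (nat \<Rightarrow> nat list \<times> nat list \<Rightarrow> 'a) sset" where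
  "map_space_over P J I f x y = sub_sset (map_space (tot P) x y) (\<lambda>k \<sigma>. \<forall>m.
      \<forall>t\<in>mono_maps m k. \<forall>s\<in>mono_maps m 1. prj P m (\<sigma> m (t, s)) = act LF 1 s (LF_edge J I f))"

text \<open>
  Composition of maps over \<open>f\<close> from \<open>x\<close> to \<open>y\<close> with given edges \<open>a i\<close> out of \<open>y\<close> is well-defined up to
  contractible choice.  \<open>comp_space\<close> is the space of maps \<open>\<sigma>\<close> together with choices \<open>\<tau> i\<close> of
  compositions: families of 2-simplices with first edge \<open>\<sigma>\<close> and last edge \<open>a i\<close>.  Forgetting \<open>\<tau>\<close> is a
  trivial fibration onto the mapping space; \<open>comp_result\<close> returns the composites.
\<close>

definition comp_space ::
  "'a over_LF \<Rightarrow> nat set \<Rightarrow> nat set \<Rightarrow> (nat \<rightharpoonup> nat) \<Rightarrow> 'a \<Rightarrow> 'a \<Rightarrow> (nat \<Rightarrow> 'a) \<Rightarrow>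
   ((nat \<Rightarrow> nat list \<times> nat list \<Rightarrow> 'a) \<times> (nat \<Rightarrow> nat \<Rightarrow> nat list \<times> nat list \<Rightarrow> 'a)) sset" where
  "comp_space P J I f x y a =
     sub_sset (sprod (map_space_over P J I f x y) (sprod_fam I (\<lambda>_. sfun (simplex 2) (tot P))))
       (\<lambda>k (\<sigma>, \<tau>). \<forall>i\<in>I. \<forall>m. \<forall>t\<in>mono_maps m k. \<forall>s\<in>mono_maps m 2.
          (set s \<subseteq> {0, 1} \<longrightarrow> \<tau> i m (t, s) = \<sigma> m (t, s)) \<and>
          (set s \<subseteq> {1, 2} \<longrightarrow> \<tau> i m (t, s) = act (tot P) 1 (map (\<lambda>v. v - 1) s) (a i)))"

definition comp_result ::
  "nat set \<Rightarrow> nat \<Rightarrow>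
   (nat \<Rightarrow> nat list \<times> nat list \<Rightarrow> 'a) \<times> (nat \<Rightarrow> nat \<Rightarrow> nat list \<times> nat list \<Rightarrow> 'a) \<Rightarrow>
   nat \<Rightarrow> nat \<Rightarrow> nat list \<times> nat list \<Rightarrow> 'a" where
  "comp_result I k z = (\<lambda>i\<in>I. \<lambda>m. \<lambda>ts\<in>cells (sprod (simplex k) (simplex 1)) m.
      snd z i m (fst ts, map (\<lambda>v. 2 * v) (snd ts)))"

definition infty_operad :: "'a over_LF \<Rightarrow> bool" where
  "infty_operad P \<longleftrightarrow> inner_fibration P \<and>
     (\<forall>J I f x. finite J \<and> finite I \<and> inert_map J I f \<and> over P J x \<longrightarrow>
        (\<exists>y e. cocartesian_over P J I f x y e)) \<and>
     (\<forall>J I f x y b a. finite J \<and> finite I \<and> f \<in> fmaps J I \<and> over P J x \<and> over P I y \<and>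
        (\<forall>i\<in>I. cocartesian_over P I {0} [i \<mapsto> 0] y (b i) (a i)) \<longrightarrow>
        (let M = comp_space P J I f x y a;
             N = sprod_fam I (\<lambda>i. map_space_over P J {0} ([i \<mapsto> 0] \<circ>\<^sub>m f) x (b i))
         in is_equivalence M N (\<lambda>k. restrict (comp_result I k) (cells M k)))) \<and>
     (\<forall>I b. finite I \<and> (\<forall>i\<in>I. over P {0} (b i)) \<longrightarrow>
        (\<exists>y a. over P I y \<and> (\<forall>i\<in>I. cocartesian_over P I {0} [i \<mapsto> 0] y (b i) (a i))))"

definition symmetric_monoidal :: "'a over_LF \<Rightarrow> bool" where
  "symmetric_monoidal P \<longleftrightarrow> infty_operad P \<and>
     (\<forall>J I f x. finite J \<and> finite I \<and> f \<in> fmaps J I \<and> over P J x \<longrightarrow>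
        (\<exists>y e. cocartesian_over P J I f x y e))"

definition inert_edge :: "'a over_LF \<Rightarrow> 'a \<Rightarrow> bool" where
  "inert_edge P e \<longleftrightarrow> cocartesian P e \<and>
     (\<exists>J I f. inert_map J I f \<and> prj P 1 e = LF_edge J I f)"

definition operad_map :: "'a over_LF \<Rightarrow> 'b over_LF \<Rightarrow> (nat \<Rightarrow> 'a \<Rightarrow> 'b) \<Rightarrow> bool" where
  "operad_map P Q F \<longleftrightarrow> F \<in> smap (tot P) (tot Q) \<and>
     (\<forall>n. \<forall>x\<in>cells (tot P) n. prj Q n (F n x) = prj P n x) \<and>
     (\<forall>e. inert_edge P e \<longrightarrow> inert_edge Q (F 1 e))"

text \<open>\<open>Alg P Q\<close> is the full subcategory, spanned by the morphisms of operads, of the category of functors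
  over \<open>LF\<close>.\<close>

definition Alg :: "'a over_LF \<Rightarrow> 'b over_LF \<Rightarrow> (nat \<Rightarrow> nat list \<times> 'a \<Rightarrow> 'b) sset" where
  "Alg P Q = full_on
     (sub_sset (sfun (tot P) (tot Q)) (\<lambda>n \<sigma>.
        \<forall>m. \<forall>t\<in>mono_maps m n. \<forall>x\<in>cells (tot P) m. prj Q m (\<sigma> m (t, x)) = prj P m x))
     (\<lambda>v. operad_map P Q (of_vertex (tot P) v))"

definition postcompose ::
  "'o over_LF \<Rightarrow> (nat \<Rightarrow> 'a \<Rightarrow> 'b) \<Rightarrow> 'a over_LF \<Rightarrow> nat \<Rightarrow>
   (nat \<Rightarrow> nat list \<times> 'o \<Rightarrow> 'a) \<Rightarrow> nat \<Rightarrow> nat list \<times> 'o \<Rightarrow> 'b" where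
  "postcompose P F Q = (\<lambda>n. \<lambda>\<sigma>\<in>cells (Alg P Q) n. smap_comp (sprod (simplex n) (tot P)) F \<sigma>)"

definition underlying :: "'a over_LF \<Rightarrow> 'a sset" where
  "underlying P = sub_sset (tot P) (\<lambda>n x. prj P n x = degen LF n (LF_object {0}))"

definition underlying_map :: "'a over_LF \<Rightarrow> (nat \<Rightarrow> 'a \<Rightarrow> 'b) \<Rightarrow> nat \<Rightarrow> 'a \<Rightarrow> 'b" where
  "underlying_map P F = smap_restrict (underlying P) F"

subsection \<open>Operadic nerves\<close>

text \<open>
  A simplicial multicategory whose colours \<open>c\<close> have an underlying simplicial set \<open>und c\<close> and in which
  \<open>mmap A D c\<close>, the operations with inputs \<open>D j\<close> for \<open>j \<in> A\<close> and output \<open>c\<close>, is a simplicial subset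
  of the simplicial set of maps from the product of the \<open>und (D j)\<close> to \<open>und c\<close>.  Composition is
  composition of maps.
\<close>

type_synonym 'u mor = "nat \<Rightarrow> nat list \<times> (nat \<Rightarrow> 'u) \<Rightarrow> 'u"

record ('c, 'u) mcat =
  colours :: "'c set"
  und :: "'c \<Rightarrow> 'u sset"
  mmap :: "nat set \<Rightarrow> (nat \<Rightarrow> 'c) \<Rightarrow> 'c \<Rightarrow> 'u mor sset"

type_synonym 'c oobj = "nat set \<times> (nat \<Rightarrow> 'c)"
type_synonym 'u omor = "(nat \<rightharpoonup> nat) \<times> (nat \<Rightarrow> 'u mor)"
type_synonym ('c, 'u) ocell = "('c oobj, 'u omor) ncell"

text \<open>Its category of operators.\<close>

definition operators :: "('c, 'u) mcat \<Rightarrow> ('c oobj, 'u omor) scat" where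
  "operators M = \<lparr>
     objs = {(I, C). finite I \<and> C \<in> I \<rightarrow>\<^sub>E colours M},
     maps = \<lambda>(J, D) (I, C).
       \<lparr>cells = \<lambda>k. {(f, g). f \<in> fmaps J I \<and> g \<in> PiE I (\<lambda>i. cells (mmap M (fib f i) D (C i)) k)},
        act = \<lambda>k \<alpha> (f, g). (f, \<lambda>i\<in>I. act (mmap M (fib f i) D (C i)) k \<alpha> (g i))\<rparr>,
     cmp = \<lambda>k (J, D) (I, C) (H, B) (f', g') (f, g).
       (f' \<circ>\<^sub>m f, \<lambda>h\<in>H. \<lambda>n.
          \<lambda>(t, x)\<in>cells (sprod (simplex k) (sprod_fam (fib (f' \<circ>\<^sub>m f) h) (\<lambda>j. und M (D j)))) n.
            g' h n (t, \<lambda>i\<in>fib f' h. g i n (t, restrict x (fib f i)))),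
     idn = \<lambda>(I, C). (pid I, \<lambda>i\<in>I. \<lambda>n.
       \<lambda>(t, x)\<in>cells (sprod (simplex 0) (sprod_fam {i} (\<lambda>j. und M (C j)))) n. x i)\<rparr>"

definition operadic_nerve :: "('c, 'u) mcat \<Rightarrow> ('c, 'u) ocell over_LF" where
  "operadic_nerve M = \<lparr>
     tot = coherent_nerve (operators M),
     prj = \<lambda>n. \<lambda>(x, \<phi>)\<in>cells (coherent_nerve (operators M)) n.
       (\<lambda>i\<in>{..n}. fst (x i), \<lambda>(i, j)\<in>pairs_le n. fst (\<phi> (i, j) 0 [{i, j}]))\<rparr>"

text \<open>The edge of the underlying category given by a unary operation, i.e. a map \<open>F\<close> from \<open>und c\<close> to
  \<open>und d\<close>.\<close>

definition unary_edge :: "('c, 'u) mcat \<Rightarrow> 'c \<Rightarrow> 'c \<Rightarrow> (nat \<Rightarrow> 'u \<Rightarrow> 'u) \<Rightarrow> ('c, 'u) ocell" where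
  "unary_edge M c d F = nerve_edge (operators M) ({0}, \<lambda>_\<in>{0}. c) ({0}, \<lambda>_\<in>{0}. d)
     ([0 \<mapsto> 0], \<lambda>_\<in>{0}. \<lambda>n.
        \<lambda>(t, x)\<in>cells (sprod (simplex 0) (sprod_fam {0} (\<lambda>_. und M c))) n. F n (x 0))"

section \<open>Spaces and Waldhausen categories\<close>

type_synonym 'u kcell = "('u sset, 'u) ocell"

definition Kan_mcat :: "('u sset, 'u) mcat" where
  "Kan_mcat = \<lparr>colours = {X. kan X \<and> small X}, und = \<lambda>X. X, mmap = \<lambda>A D X. sfun (sprod_fam A D) X\<rparr>"

definition Kan_tensor :: "'u kcell over_LF" where
  "Kan_tensor = operadic_nerve Kan_mcat"

definition spaces :: "'u kcell sset" where
  "spaces = underlying Kan_tensor"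

text \<open>The Kan complexes at the ends of an edge of \<open>spaces\<close>, and the map between them.\<close>

definition edge_src :: "'u kcell \<Rightarrow> 'u sset" where "edge_src e = snd (fst e 0) 0"
definition edge_tgt :: "'u kcell \<Rightarrow> 'u sset" where "edge_tgt e = snd (fst e 1) 0"
definition edge_map :: "'u kcell \<Rightarrow> nat \<Rightarrow> 'u \<Rightarrow> 'u" where
  "edge_map e = (\<lambda>n. \<lambda>x\<in>cells (edge_src e) n.
     snd (snd e (0, 1) 0 [{0, 1}]) 0 n (replicate (Suc n) 0, \<lambda>_\<in>{0}. x))"

text \<open>Pairs consist of a quasicategory and the set of ingressive edges.\<close>

type_synonym 'u wpair = "'u sset \<times> 'u set"

definition is_pair :: "'a sset \<times> 'a set \<Rightarrow> bool" where
  "is_pair CE \<longleftrightarrow> (case CE of (C, E) \<Rightarrow>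
     quasicat C \<and> E \<subseteq> cells C 1 \<and> (\<forall>e. is_equiv C e \<longrightarrow> e \<in> E) \<and>
     (\<forall>s\<in>cells C 2. act C 2 [0, 1] s \<in> E \<and> act C 2 [1, 2] s \<in> E \<longrightarrow> act C 2 [0, 2] s \<in> E))"

definition waldhausen :: "'a sset \<times> 'a set \<Rightarrow> bool" where
  "waldhausen CE \<longleftrightarrow> (case CE of (C, E) \<Rightarrow>
     is_pair (C, E) \<and> (\<exists>z. zero_object C z) \<and>
     (\<forall>z f. zero_object C z \<and> f \<in> cells C 1 \<and> src C f = z \<longrightarrow> f \<in> E) \<and>
     (\<forall>f\<in>E. \<forall>g\<in>cells C 1. src C g = src C f \<longrightarrow>
        (\<exists>q. pushout_square C q \<and> sq_top q = f \<and> sq_left q = g)) \<and>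
     (\<forall>q. pushout_square C q \<and> sq_top q \<in> E \<longrightarrow> sq_bottom q \<in> E))"

definition exact :: "'a sset \<times> 'a set \<Rightarrow> 'b sset \<times> 'b set \<Rightarrow> (nat \<Rightarrow> 'a \<Rightarrow> 'b) \<Rightarrow> bool" where
  "exact D C F \<longleftrightarrow> F \<in> smap (fst D) (fst C) \<and> (\<forall>e\<in>snd D. F 1 e \<in> snd C) \<and>
     (\<forall>z. zero_object (fst D) z \<longrightarrow> zero_object (fst C) (F 0 z)) \<and>
     (\<forall>q. pushout_square (fst D) q \<and> sq_top q \<in> snd D \<longrightarrow>
        pushout_square (fst C) (smap_comp square F q))"

definition multi_exact ::
  "nat set \<Rightarrow> (nat \<Rightarrow> 'u wpair) \<Rightarrow> 'u wpair \<Rightarrow> (nat \<Rightarrow> (nat \<Rightarrow> 'u) \<Rightarrow> 'u) \<Rightarrow> bool" where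
  "multi_exact A D C F \<longleftrightarrow> (let X = sprod_fam A (\<lambda>j. fst (D j)) in
     F \<in> smap X (fst C) \<and>
     (\<forall>x\<in>cells X 1. (\<forall>j\<in>A. x j \<in> snd (D j)) \<longrightarrow> F 1 x \<in> snd C) \<and>
     (\<forall>j\<in>A. \<forall>d\<in>cells X 0.
        exact (D j) C (\<lambda>n. \<lambda>y\<in>cells (fst (D j)) n. F n ((degen X n d)(j := y)))))"

type_synonym 'u wcell = "('u wpair, 'u) ocell"

definition Wald_mcat :: "('u wpair, 'u) mcat" where
  "Wald_mcat = \<lparr>colours = {C. waldhausen C \<and> small (fst C)}, und = fst,
     mmap = \<lambda>A D C. let X = sprod_fam A (\<lambda>j. fst (D j)) in
       core (full_on (sfun X (fst C)) (\<lambda>v. multi_exact A D C (of_vertex X v)))\<rparr>"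

definition Wald_tensor :: "'u wcell over_LF" where
  "Wald_tensor = operadic_nerve Wald_mcat"

text \<open>The multiplicative theory sending each colour to its maximal Kan subcomplex and restricting
  operations accordingly.\<close>

definition iota_tensor :: "nat \<Rightarrow> 'u wcell \<Rightarrow> 'u kcell" where
  "iota_tensor = (\<lambda>n. \<lambda>(x, \<phi>)\<in>cells (tot Wald_tensor) n.
     (\<lambda>i\<in>{..n}. (fst (x i), \<lambda>a\<in>fst (x i). core (fst (snd (x i) a))),
      \<lambda>(i, j)\<in>pairs_le n. \<lambda>k. \<lambda>c\<in>cells (paths i j) k.
        (case \<phi> (i, j) k c of (f, g) \<Rightarrow>
          (f, \<lambda>a\<in>fst (x j). smap_restrict
             (sprod (simplex k) (sprod_fam (fib f a) (\<lambda>b. core (fst (snd (x i) b))))) (g a)))))"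

section \<open>Additive and multiplicative theories\<close>

definition theory_functor :: "(nat \<Rightarrow> 'u wcell \<Rightarrow> 'u kcell) \<Rightarrow> bool" where
  "theory_functor \<phi> \<longleftrightarrow> \<phi> \<in> smap (underlying Wald_tensor) spaces \<and>
     (\<forall>(J :: 'u sset) f. small J \<and> filtered J \<and> colimit_cocone (underlying Wald_tensor) J f \<longrightarrow>
        colimit_cocone spaces J (smap_comp (join J (simplex 0)) \<phi> f)) \<and>
     (\<forall>z. zero_object (underlying Wald_tensor) z \<longrightarrow> terminal spaces (\<phi> 0 z))"

text \<open>
  The pair \<open>E(C)\<close> of cofiber sequences, as pushout squares with corners \<open>X\<close> at \<open>(0,0)\<close>, \<open>Y\<close> at \<open>(0,1)\<close>, a
  zero object at \<open>(1,0)\<close> and \<open>Y/X\<close> at \<open>(1,1)\<close>.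
\<close>

definition cofib_seqs :: "'a sset \<times> 'a set \<Rightarrow>
    (nat \<Rightarrow> nat list \<times> (nat list \<times> nat list) \<Rightarrow> 'a) sset \<times>
    (nat \<Rightarrow> nat list \<times> (nat list \<times> nat list) \<Rightarrow> 'a) set" where
  "cofib_seqs CE = (case CE of (C, E) \<Rightarrow>
     let X = full_on (sfun square C) (\<lambda>v. let q = of_vertex square v in
               pushout_square C q \<and> sq_top q \<in> E \<and> zero_object C (q 0 ([1], [0])))
     in (X, {e \<in> cells X 1. \<forall>v\<in>{([0], [0]), ([0], [1]), ([1], [1])}. eval_at square v 1 e \<in> E}))"

definition pair_iso :: "'a sset \<times> 'a set \<Rightarrow> 'b sset \<times> 'b set \<Rightarrow> (nat \<Rightarrow> 'a \<Rightarrow> 'b) \<Rightarrow> bool" where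
  "pair_iso C D F \<longleftrightarrow> F \<in> smap (fst C) (fst D) \<and>
     (\<forall>n. bij_betw (F n) (cells (fst C) n) (cells (fst D) n)) \<and> F 1 ` snd C = snd D"

definition pi0_class :: "'a sset \<Rightarrow> 'a \<Rightarrow> 'a set" where
  "pi0_class X v = {w. (v, w) \<in> ({(src X e, tgt X e) | e. e \<in> cells X 1} \<union>
                                   {(tgt X e, src X e) | e. e \<in> cells X 1})\<^sup>*}"

definition pi0 :: "'a sset \<Rightarrow> 'a set set" where
  "pi0 X = pi0_class X ` cells X 0"

text \<open>
  If \<open>(r1, r2)\<close> is an equivalence from \<open>X\<close> to \<open>Y \<times> Y\<close>, then \<open>m\<close> from \<open>X\<close> to \<open>Y\<close> composed with its inverse is a
  multiplication on \<open>Y\<close>.  It is grouplike if it makes the set of components of \<open>Y\<close> a group.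
\<close>

definition grouplike_span :: "'a sset \<Rightarrow> 'b sset \<Rightarrow> (nat \<Rightarrow> 'a \<Rightarrow> 'b) \<Rightarrow> (nat \<Rightarrow> 'a \<Rightarrow> 'b) \<Rightarrow>
    (nat \<Rightarrow> 'a \<Rightarrow> 'b) \<Rightarrow> bool" where
  "grouplike_span X Y r1 r2 m \<longleftrightarrow> (\<exists>u. group \<lparr>carrier = pi0 Y,
     mult = \<lambda>a b. THE c. \<exists>x\<in>cells X 0. a = pi0_class Y (r1 0 x) \<and> b = pi0_class Y (r2 0 x) \<and>
                                         c = pi0_class Y (m 0 x),
     one = u\<rparr>)"

text \<open>
  The simplices of \<open>cofib_seqs C\<close> do not live in \<open>'u\<close>, so a theory is evaluated on isomorphic copies \<open>S\<close>
  that do.  The maps \<open>r1\<close>, \<open>r2\<close>, \<open>m\<close> are \<open>X\<close>, \<open>Y/X\<close>, \<open>Y\<close>.  Since \<open>i\<close> followed by \<open>(r1, r2)\<close> is equivalent to the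
  identity, applying a theory to \<open>i\<close> inverts the equivalence it assigns to \<open>(r1, r2)\<close>.
\<close>

definition additive :: "(nat \<Rightarrow> 'u wcell \<Rightarrow> 'u kcell) \<Rightarrow> bool" where
  "additive \<phi> \<longleftrightarrow> theory_functor \<phi> \<and>
     (\<forall>C\<in>colours Wald_mcat. \<forall>S\<in>colours Wald_mcat. \<forall>e. pair_iso S (cofib_seqs C) e \<longrightarrow>
       (let ev = (\<lambda>v. \<lambda>n. \<lambda>x\<in>cells (fst S) n. eval_at square v n (e n x));
            at = (\<lambda>v. \<phi> 1 (unary_edge Wald_mcat S C (ev v)));
            X = edge_src (at ([0], [0])); Y = edge_tgt (at ([0], [0]));
            r1 = edge_map (at ([0], [0])); r2 = edge_map (at ([1], [1]));
            m = edge_map (at ([0], [1]))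
        in is_equivalence X (sprod Y Y) (\<lambda>n. \<lambda>x\<in>cells X n. (r1 n x, r2 n x)) \<and>
           grouplike_span X Y r1 r2 m))"

definition multiplicative_theory :: "(nat \<Rightarrow> 'u wcell \<Rightarrow> 'u kcell) \<Rightarrow> bool" where
  "multiplicative_theory \<phi> \<longleftrightarrow> operad_map Wald_tensor Kan_tensor \<phi> \<and>
     theory_functor (underlying_map Wald_tensor \<phi>)"

definition Mult_theories :: "(nat \<Rightarrow> nat list \<times> 'u wcell \<Rightarrow> 'u kcell) sset" where
  "Mult_theories = full_on (Alg Wald_tensor Kan_tensor)
     (\<lambda>v. multiplicative_theory (of_vertex (tot Wald_tensor) v))"

text \<open>\<open>D_tensor \<phi> \<psi>\<close>: the multiplicative theory \<open>\<psi>\<close> is the value at \<open>\<phi>\<close> of the left adjoint \<open>D\<close> to the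
  inclusion of the multiplicative theories with additive underlying theory.\<close>

definition D_tensor ::
  "(nat \<Rightarrow> 'u wcell \<Rightarrow> 'u kcell) \<Rightarrow> (nat \<Rightarrow> 'u wcell \<Rightarrow> 'u kcell) \<Rightarrow> bool" where
  "D_tensor \<phi> \<psi> \<longleftrightarrow> (\<exists>\<eta>.
     localization_unit Mult_theories
       (\<lambda>v. additive (underlying_map Wald_tensor (of_vertex (tot Wald_tensor) v)))
       (to_vertex (tot Wald_tensor) \<phi>) \<eta> \<and>
     of_vertex (tot Wald_tensor) (tgt Mult_theories \<eta>) = \<psi>)"

definition K_tensor :: "(nat \<Rightarrow> 'u wcell \<Rightarrow> 'u kcell) \<Rightarrow> bool" where
  "K_tensor K \<longleftrightarrow> D_tensor iota_tensor K"

section \<open>Spectra\<close>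

text \<open>Finite spaces: the smallest full subcategory containing the point and closed under finite colimits.\<close>

definition finite_spaces :: "'u kcell set" where
  "finite_spaces = \<Inter>{S. S \<subseteq> cells spaces 0 \<and> (\<forall>x. terminal spaces x \<longrightarrow> x \<in> S) \<and>
     (\<forall>(K :: nat sset) f. finite_sset K \<and> colimit_cocone spaces K f \<and>
        (\<forall>v\<in>cells K 0. f 0 (JL v) \<in> S) \<longrightarrow> f 0 (JR [0]) \<in> S)}"

text \<open>Pointed objects are edges with terminal source.\<close>

type_synonym 'u pcell = "nat \<Rightarrow> nat list \<times> nat list \<Rightarrow> 'u kcell"

definition pointed_finite_spaces :: "'u pcell sset" where
  "pointed_finite_spaces = full_on (sfun (simplex 1) spaces) (\<lambda>v.
     let q = of_vertex (simplex 1) v in terminal spaces (q 0 [0]) \<and> q 0 [1] \<in> finite_spaces)"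

type_synonym 'u scell = "nat \<Rightarrow> nat list \<times> 'u pcell \<Rightarrow> 'u kcell"

text \<open>Spectra are the reduced excisive functors from pointed finite spaces to spaces.\<close>

definition spectra :: "'u scell sset" where
  "spectra = full_on (sfun pointed_finite_spaces spaces) (\<lambda>v.
     let F = of_vertex pointed_finite_spaces v in
       (\<forall>z. terminal pointed_finite_spaces z \<longrightarrow> terminal spaces (F 0 z)) \<and>
       (\<forall>q. pushout_square pointed_finite_spaces q \<longrightarrow>
          pullback_square spaces (smap_comp square F q)))"

text \<open>The zero-sphere: a coproduct of two points (\<open>bdry 1\<close> being discrete on two vertices), pointed by
  one of the coprojections.\<close>

definition zero_sphere :: "'u pcell \<Rightarrow> bool" where
  "zero_sphere s \<longleftrightarrow> s \<in> cells pointed_finite_spaces 0 \<and>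
     (\<exists>q. colimit_cocone spaces (bdry 1) q \<and> terminal spaces (q 0 (JL [0])) \<and>
          terminal spaces (q 0 (JL [1])) \<and> of_vertex (simplex 1) s 1 [0, 1] = q 1 (JB 0 [0] [0]))"

definition Omega_inf :: "'u pcell \<Rightarrow> nat \<Rightarrow> 'u scell \<Rightarrow> 'u kcell" where
  "Omega_inf s = (\<lambda>n. \<lambda>\<sigma>\<in>cells spectra n. eval_at pointed_finite_spaces s n \<sigma>)"

text \<open>The category of elements of a functor \<open>G\<close> to spaces: pairs of an object of \<open>X\<close> and a point of its
  value.  An initial object of it is a corepresenting object together with its universal point.\<close>

definition elements ::
  "'a sset \<Rightarrow> (nat \<Rightarrow> 'a \<Rightarrow> 'u kcell) \<Rightarrow> 'u kcell \<Rightarrow> ('a \<times> 'u kcell) sset" where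
  "elements X G pt = sub_sset (sprod X (under_object spaces pt))
     (\<lambda>n (\<sigma>, \<tau>). act spaces (Suc n) [1..<Suc (Suc n)] \<tau> = G n \<sigma>)"

definition sphere_spectrum :: "'u scell \<Rightarrow> bool" where
  "sphere_spectrum S \<longleftrightarrow> (\<exists>s pt u. zero_sphere s \<and> terminal spaces pt \<and>
     initial (elements spectra (Omega_inf s) pt) (S, u))"

text \<open>Connectivity for the standard t-structure, whose \<open>(-1)\<close>-truncated objects are the spectra with
  contractible infinite loop space.\<close>

definition connective :: "'u scell \<Rightarrow> bool" where
  "connective X \<longleftrightarrow> X \<in> cells spectra 0 \<and>
     (\<forall>s Y. zero_sphere s \<and> Y \<in> cells spectra 0 \<and> terminal spaces (Omega_inf s 0 Y) \<longrightarrow>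
        contractible (map_space spectra X Y))"

text \<open>\<open>cocartesian_transf P X J I f F G\<close>: there is a natural transformation over \<open>f\<close> from \<open>F\<close> to \<open>G\<close>, both
  of shape \<open>X\<close>, with cocartesian components, so that \<open>G\<close> is the pushforward of \<open>F\<close> along \<open>f\<close>.\<close>

definition cocartesian_transf :: "'a over_LF \<Rightarrow> 'k sset \<Rightarrow> nat set \<Rightarrow> nat set \<Rightarrow> (nat \<rightharpoonup> nat) \<Rightarrow>
    (nat \<Rightarrow> 'k \<Rightarrow> 'a) \<Rightarrow> (nat \<Rightarrow> 'k \<Rightarrow> 'a) \<Rightarrow> bool" where
  "cocartesian_transf P X J I f F G \<longleftrightarrow> F \<in> smap X (tot P) \<and> G \<in> smap X (tot P) \<and>
     (\<exists>T\<in>cells (sfun X (tot P)) 1.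
        (\<forall>m. \<forall>t\<in>mono_maps m 1. \<forall>x\<in>cells X m. prj P m (T m (t, x)) = act LF 1 t (LF_edge J I f)) \<and>
        src (sfun X (tot P)) T = to_vertex X F \<and> tgt (sfun X (tot P)) T = to_vertex X G \<and>
        (\<forall>x\<in>cells X 0. cocartesian P (T 1 ([0, 1], degen X 1 x))))"

text \<open>The tensor product with a fixed object, in either variable, preserves colimits: \<open>B\<close> is a cocone over
  the two-element set with components the colimit cocone \<open>A\<close> and the constant cocone on \<open>y\<close>, and \<open>G\<close> is
  its tensor product.\<close>

definition tensor_preserves_colimits :: "'a over_LF \<Rightarrow> 'k sset \<Rightarrow> bool" where
  "tensor_preserves_colimits P K \<longleftrightarrow> (\<forall>i\<in>{0, 1}. \<forall>A B G y. let X = join K (simplex 0) in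
     colimit_cocone (underlying P) K A \<and>
     cocartesian_transf P X {0, 1} {0} [i \<mapsto> 0] B A \<and>
     cocartesian_transf P X {0, 1} {0} [1 - i \<mapsto> 0] B
       (\<lambda>n. \<lambda>_\<in>cells X n. degen (tot P) n y) \<and>
     cocartesian_transf P X {0, 1} {0} [0 \<mapsto> 0, 1 \<mapsto> 0] B G \<longrightarrow>
     colimit_cocone (underlying P) K G)"

definition tensor_unit :: "'a over_LF \<Rightarrow> 'a \<Rightarrow> bool" where
  "tensor_unit P u \<longleftrightarrow> (\<exists>x e. over P {} x \<and> cocartesian_over P {} {0} Map.empty x u e)"

text \<open>
  The smash product is, up to a contractible choice, the only symmetric monoidal structure on spectra that
  preserves small colimits in each variable and has the sphere spectrum as unit.  Here \<open>\<Theta>\<close> identifies the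
  underlying category of \<open>P\<close> with spectra.
\<close>

definition smash_product :: "'s over_LF \<Rightarrow> (nat \<Rightarrow> 's \<Rightarrow> 'u scell) \<Rightarrow> bool" where
  "smash_product P \<Theta> \<longleftrightarrow> symmetric_monoidal P \<and> is_equivalence (underlying P) spectra \<Theta> \<and>
     (\<forall>u. tensor_unit P u \<longrightarrow> sphere_spectrum (\<Theta> 0 u)) \<and>
     (\<forall>K :: 'u sset. is_sset K \<and> small K \<longrightarrow> tensor_preserves_colimits P K)"

text \<open>The lax symmetric monoidal structure on the infinite loop space functor.\<close>

definition Omega_tensor ::
  "'s over_LF \<Rightarrow> (nat \<Rightarrow> 's \<Rightarrow> 'u scell) \<Rightarrow> (nat \<Rightarrow> 's \<Rightarrow> 'u kcell) \<Rightarrow> bool" where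
  "Omega_tensor P \<Theta> W \<longleftrightarrow> operad_map P Kan_tensor W \<and>
     (\<exists>s. zero_sphere s \<and> nat_equiv (underlying P) spaces (underlying_map P W)
             (smap_comp (underlying P) (Omega_inf s) \<Theta>))"

text \<open>
  The connective multiplicative \<open>K\<close>-theory \<open>KK\<close>: the lift of \<open>K\<close> along the infinite loop space functor to a
  morphism of operads with connective values.
\<close>

definition connective_K_tensor ::
  "'s over_LF \<Rightarrow> (nat \<Rightarrow> 's \<Rightarrow> 'u scell) \<Rightarrow> (nat \<Rightarrow> 'u wcell \<Rightarrow> 'u kcell) \<Rightarrow>
   (nat \<Rightarrow> 'u wcell \<Rightarrow> 's) \<Rightarrow> bool" where
  "connective_K_tensor P \<Theta> K KK \<longleftrightarrow> operad_map Wald_tensor P KK \<and>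
     (\<forall>C\<in>cells (underlying Wald_tensor) 0. connective (\<Theta> 0 (KK 0 C))) \<and>
     (\<exists>W h. Omega_tensor P \<Theta> W \<and> is_equiv (Alg Wald_tensor Kan_tensor) h \<and>
        src (Alg Wald_tensor Kan_tensor) h =
          to_vertex (tot Wald_tensor) (smap_comp (tot Wald_tensor) W KK) \<and>
        tgt (Alg Wald_tensor Kan_tensor) h = to_vertex (tot Wald_tensor) K)"

end

theory Submission
  imports Defs
begin

text \<open>Postcomposition with a morphism of operads \<open>F\<close> from \<open>P\<close> to
  \<open>Q\<close> is a simplicial map on functor complexes, since it commutes with precomposition
  by simplicial operators (\<open>act_sfun_smap_comp\<close>). It restricts to algebras:
  \<open>F\<close> lies over \<open>LF\<close>, so composites stay over \<open>LF\<close>, and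
  \<open>Alg\<close> is a full subcategory, so beyond that only vertices matter, where morphisms of
  operads compose (\<open>operad_map_comp\<close>). This gives \<open>postcompose_smap\<close>.

  It remains to see that \<open>K\<close> and \<open>KK\<close> are morphisms of operads. For
  \<open>KK\<close> this is part of its characterization as a lift of \<open>K\<close>. For
  \<open>K\<close> it holds because \<open>K\<close> is the target of a localization unit inside the
  full subcategory of multiplicative theories (\<open>D_tensor_multiplicative\<close>).\<close>

lemma mono_maps_comp:
  assumes "\<alpha> \<in> mono_maps m n" and "\<beta> \<in> mono_maps k m"
  shows "map ((!) \<alpha>) \<beta> \<in> mono_maps k n"
proof -
  have bound: "b < length \<alpha>" if "b \<in> set \<beta>" for b
    using assms that by (auto simp: mono_maps_def)
  have "sorted (map ((!) \<alpha>) \<beta>)"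
    using assms bound
    by (auto simp: mono_maps_def sorted_map
        intro!: sorted_wrt_mono_rel[of \<beta> "(\<le>)"] sorted_nth_mono)
  moreover have "set (map ((!) \<alpha>) \<beta>) \<subseteq> {..n}"
    using assms(1) bound nth_mem by (auto simp: mono_maps_def subset_iff)
  ultimately show ?thesis
    using assms by (simp add: mono_maps_def)
qed

text \<open>Associativity of composition in the simplex category, in the list encoding. The entries
  of \<open>\<gamma>\<close> are valid indices into \<open>\<beta>\<close>, so no lookup runs out of
  range.\<close>

lemma nth_comp:
  assumes "\<beta> \<in> mono_maps k m" and "\<gamma> \<in> mono_maps l k"
  shows "map ((!) (map ((!) \<alpha>) \<beta>)) \<gamma> = map ((!) \<alpha>) (map ((!) \<beta>) \<gamma>)"
proof -
  have "c < length \<beta>" if "c \<in> set \<gamma>" for c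
    using assms that by (auto simp: mono_maps_def)
  then show ?thesis by simp
qed

lemma singleton_mono_maps: "i \<le> n \<Longrightarrow> [i] \<in> mono_maps 0 n"
  by (simp add: mono_maps_def)

lemma replicate_mono_maps: "replicate (Suc m) 0 \<in> mono_maps m n"
  by (auto simp: mono_maps_def)

text \<open>The assumption on \<open>X\<close> is closure under the structure maps instead of
  \<open>is_sset\<close>, so that for products \<open>sprod (simplex n) X\<close> the simplicial
  identities need not be verified. Closure matters because \<open>smap_comp\<close> is extensional:
  \<open>act X n \<alpha> x\<close> must again be a cell.\<close>

lemma smap_comp_smap:
  assumes "\<And>m n \<alpha> x. \<alpha> \<in> mono_maps m n \<Longrightarrow> x \<in> cells X n \<Longrightarrow> act X n \<alpha> x \<in> cells X m"
    and "f \<in> smap X Y" and "g \<in> smap Y Z"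
  shows "smap_comp X g f \<in> smap X Z"
proof -
  have f: "f n x \<in> cells Y n" if "x \<in> cells X n" for n x
    using assms(2) that by (auto simp: smap_def dest: PiE_mem)
  have g: "g n y \<in> cells Z n" if "y \<in> cells Y n" for n y
    using assms(3) that by (auto simp: smap_def dest: PiE_mem)
  have "f m (act X n \<alpha> x) = act Y n \<alpha> (f n x)"
    if "\<alpha> \<in> mono_maps m n" "x \<in> cells X n" for m n \<alpha> x
    using assms(2) that by (auto simp: smap_def)
  moreover have "g m (act Y n \<alpha> y) = act Z n \<alpha> (g n y)"
    if "\<alpha> \<in> mono_maps m n" "y \<in> cells Y n" for m n \<alpha> y
    using assms(3) that by (auto simp: smap_def)
  ultimately show ?thesis
    using f g assms(1) by (auto simp: smap_def smap_comp_def)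
qed

lemma act_sprod_simplex:
  assumes "is_sset X" and "\<alpha> \<in> mono_maps m k" and "z \<in> cells (sprod (simplex n) X) k"
  shows "act (sprod (simplex n) X) k \<alpha> z \<in> cells (sprod (simplex n) X) m"
  using assms unfolding is_sset_def
  by (auto simp: sprod_def simplex_def intro: mono_maps_comp)

lemma act_sfun:
  assumes "\<alpha> \<in> mono_maps m n"
  shows "act (sfun X Y) n \<alpha> \<sigma> = (\<lambda>k. \<lambda>z\<in>cells (sprod (simplex m) X) k.
           \<sigma> k (map ((!) \<alpha>) (fst z), snd z))"
  using assms by (simp add: sfun_def mono_maps_def)

lemma act_sfun_smap:
  assumes X: "is_sset X" and \<alpha>: "\<alpha> \<in> mono_maps m n"
    and \<sigma>: "\<sigma> \<in> smap (sprod (simplex n) X) Y"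
  shows "act (sfun X Y) n \<alpha> \<sigma> \<in> smap (sprod (simplex m) X) Y"
proof -
  \<comment> \<open>\<open>r\<close> is the product of the map of simplices induced by
    \<open>\<alpha>\<close> with the identity of \<open>X\<close>; acting by \<open>\<alpha>\<close>
    is precomposition with \<open>r\<close>.\<close>
  define r where "r = (\<lambda>k. \<lambda>z\<in>cells (sprod (simplex m) X) k. (map ((!) \<alpha>) (fst z), snd z))"
  have "r \<in> smap (sprod (simplex m) X) (sprod (simplex n) X)"
    using act_sprod_simplex[OF X] mono_maps_comp[OF \<alpha>] mono_maps_comp X
    unfolding smap_def r_def is_sset_def
    by (auto simp: sprod_def simplex_def nth_comp)
  from smap_comp_smap[OF act_sprod_simplex[OF X] this \<sigma>]
  show ?thesis
    by (simp add: act_sfun[OF \<alpha>] smap_comp_def r_def cong: restrict_cong)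
qed

text \<open>Used to pass the condition on vertices in \<open>Alg\<close> from a simplex to its
  images under the structure maps.\<close>

lemma act_sfun_act_vertex:
  assumes \<alpha>: "\<alpha> \<in> mono_maps m n" and i: "i \<le> m"
  shows "act (sfun X Y) m [i] (act (sfun X Y) n \<alpha> \<sigma>) = act (sfun X Y) n [\<alpha> ! i] \<sigma>"
proof -
  have "\<alpha> ! i \<le> n"
    using assms by (auto simp: mono_maps_def subset_iff)
  note v = singleton_mono_maps[OF this] singleton_mono_maps[OF i]
  \<comment> \<open>The list \<open>[\<alpha> ! i]\<close> is the composite
    \<open>map ((!) \<alpha>) [i]\<close>, so this is an instance of associativity.\<close>
  have "map ((!) \<alpha> \<circ> (!) [i]) \<beta> = map ((!) [\<alpha> ! i]) \<beta>" if "\<beta> \<in> mono_maps k 0" for \<beta> k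
    using nth_comp[OF v(2) that, of \<alpha>] by (simp only: map_map list.map)
  then show ?thesis
    using mono_maps_comp[OF v(2)]
    by (auto simp: act_sfun[OF \<alpha>] act_sfun[OF v(1)] act_sfun[OF v(2)] sprod_def simplex_def
        simp del: map_eq_conv intro!: ext restrict_ext)
qed

lemma Alg_cells:
  "\<sigma> \<in> cells (Alg P Q) n \<longleftrightarrow> \<sigma> \<in> smap (sprod (simplex n) (tot P)) (tot Q) \<and>
     (\<forall>m. \<forall>t\<in>mono_maps m n. \<forall>x\<in>cells (tot P) m. prj Q m (\<sigma> m (t, x)) = prj P m x) \<and>
     (\<forall>i\<le>n. operad_map P Q (of_vertex (tot P) (act (sfun (tot P) (tot Q)) n [i] \<sigma>)))"
  by (simp add: Alg_def full_on_def sub_sset_def) (simp add: sfun_def)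

lemma act_Alg: "act (Alg P Q) = act (sfun (tot P) (tot Q))"
  by (simp add: Alg_def full_on_def sub_sset_def)

lemma act_Alg_cells:
  assumes P: "is_sset (tot P)" and \<alpha>: "\<alpha> \<in> mono_maps m n" and \<sigma>: "\<sigma> \<in> cells (Alg P Q) n"
  shows "act (Alg P Q) n \<alpha> \<sigma> \<in> cells (Alg P Q) m"
proof -
  have "\<alpha> ! i \<le> n" if "i \<le> m" for i
    using \<alpha> that by (auto simp: mono_maps_def subset_iff)
  moreover have "prj Q k (act (sfun (tot P) (tot Q)) n \<alpha> \<sigma> k (t, x)) = prj P k x"
    if "t \<in> mono_maps k m" "x \<in> cells (tot P) k" for k t x
    using \<sigma> that mono_maps_comp[OF \<alpha> that(1)]
    by (simp add: Alg_cells act_sfun[OF \<alpha>] sprod_def simplex_def)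
  ultimately show ?thesis
    using \<sigma> act_sfun_smap[OF P \<alpha>, of \<sigma> "tot Q"]
    by (simp add: Alg_cells act_Alg act_sfun_act_vertex[OF \<alpha>])
qed

lemma operad_map_comp:
  assumes P: "is_sset (tot P)" and F: "operad_map P Q F" and G: "operad_map Q R G"
  shows "operad_map P R (smap_comp (tot P) G F)"
proof -
  have "smap_comp (tot P) G F \<in> smap (tot P) (tot R)"
    using P F G by (intro smap_comp_smap) (auto simp: is_sset_def operad_map_def)
  moreover have "F n x \<in> cells (tot Q) n" if "x \<in> cells (tot P) n" for n x
    using F that by (auto simp: operad_map_def smap_def dest: PiE_mem)
  \<comment> \<open>On a cell the extensional composite takes the value \<open>G 1 (F 1 e)\<close>,
    to which preservation of inert edges by \<open>F\<close> and then by \<open>G\<close>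
    applies.\<close>
  moreover have "e \<in> cells (tot P) 1" if "inert_edge P e" for e
    using that by (simp add: inert_edge_def cocartesian_def)
  ultimately show ?thesis
    using F G by (simp add: operad_map_def) (simp add: smap_comp_def)
qed

text \<open>Precomposition and postcomposition commute. The structure maps of
  \<open>sfun X Y\<close> do not depend on the target \<open>Y\<close>, which is therefore free here
  and is fixed where the lemma is applied.\<close>

lemma act_sfun_smap_comp:
  assumes \<alpha>: "\<alpha> \<in> mono_maps m n"
  shows "act (sfun X Z) n \<alpha> (smap_comp (sprod (simplex n) X) F \<sigma>) =
         smap_comp (sprod (simplex m) X) F (act (sfun X Y) n \<alpha> \<sigma>)"
  using mono_maps_comp[OF \<alpha>]
  by (auto simp: act_sfun[OF \<alpha>] smap_comp_def sprod_def simplex_def intro!: ext restrict_ext)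

lemma of_vertex_smap_comp:
  "of_vertex X (smap_comp (sprod (simplex 0) X) F \<sigma>) = smap_comp X F (of_vertex X \<sigma>)"
  using replicate_mono_maps
  by (auto simp: of_vertex_def smap_comp_def sprod_def simplex_def intro!: ext restrict_ext
      simp del: replicate_Suc)

lemma smap_comp_Alg_cells:
  assumes O: "is_sset (tot O')" and F: "operad_map P Q F" and \<sigma>: "\<sigma> \<in> cells (Alg O' P) n"
  shows "smap_comp (sprod (simplex n) (tot O')) F \<sigma> \<in> cells (Alg O' Q) n"
proof -
  have \<sigma>_smap: "\<sigma> \<in> smap (sprod (simplex n) (tot O')) (tot P)"
    using \<sigma> by (simp add: Alg_cells)
  have "smap_comp (sprod (simplex n) (tot O')) F \<sigma> \<in> smap (sprod (simplex n) (tot O')) (tot Q)"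
    using F \<sigma>_smap by (intro smap_comp_smap act_sprod_simplex[OF O]) (auto simp: operad_map_def)
  moreover have "prj Q m (smap_comp (sprod (simplex n) (tot O')) F \<sigma> m (t, x)) = prj O' m x"
    if "t \<in> mono_maps m n" "x \<in> cells (tot O') m" for m t x
  proof -
    have tx: "(t, x) \<in> cells (sprod (simplex n) (tot O')) m"
      using that by (simp add: sprod_def simplex_def)
    then have "\<sigma> m (t, x) \<in> cells (tot P) m"
      using \<sigma>_smap by (auto simp: smap_def dest: PiE_mem)
    then show ?thesis
      using tx that F \<sigma> by (simp add: smap_comp_def operad_map_def Alg_cells)
  qed
  \<comment> \<open>The \<open>i\<close>-th vertex of the composite is \<open>F\<close> after the
    \<open>i\<close>-th vertex of \<open>\<sigma>\<close>, hence a composite of two morphisms of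
    operads.\<close>
  moreover have "operad_map O' Q (of_vertex (tot O')
      (act (sfun (tot O') (tot Q)) n [i] (smap_comp (sprod (simplex n) (tot O')) F \<sigma>)))"
    if "i \<le> n" for i
    using operad_map_comp[OF O _ F] \<sigma> that
    by (simp add: Alg_cells act_sfun_smap_comp[OF singleton_mono_maps[OF that], where Y = "tot P"]
        of_vertex_smap_comp)
  ultimately show ?thesis
    by (simp add: Alg_cells)
qed

text \<open>Closure of \<open>Alg O' P\<close> under the structure maps enters the naturality:
  \<open>postcompose\<close> is \<open>undefined\<close> off the cells of
  \<open>Alg O' P\<close>.\<close>

lemma postcompose_smap:
  assumes "is_sset (tot O')" and "operad_map P Q F"
  shows "postcompose O' F P \<in> smap (Alg O' P) (Alg O' Q)"
  using smap_comp_Alg_cells[OF assms] act_Alg_cells[OF assms(1), where Q = P]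
  by (auto simp: smap_def postcompose_def act_Alg act_sfun_smap_comp[where Y = "tot P"])

text \<open>The unit of the localization is an edge of the full subcategory of multiplicative theories, so
  its target is one of them.\<close>

lemma D_tensor_multiplicative:
  assumes "D_tensor \<phi> \<psi>"
  shows "multiplicative_theory \<psi>"
proof -
  from assms obtain \<eta> where "localization_unit Mult_theories
       (\<lambda>v. additive (underlying_map Wald_tensor (of_vertex (tot Wald_tensor) v)))
       (to_vertex (tot Wald_tensor) \<phi>) \<eta>"
    and \<psi>: "of_vertex (tot Wald_tensor) (tgt Mult_theories \<eta>) = \<psi>"
    unfolding D_tensor_def by blast
  then have "\<eta> \<in> cells Mult_theories 1"
    unfolding localization_unit_def initial_def
    by (simp add: full_on_def sub_sset_def under_object_def)
  then have "multiplicative_theory (of_vertex (tot Wald_tensor) (tgt Mult_theories \<eta>))"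
    by (simp add: Mult_theories_def full_on_def[of "Alg _ _"] sub_sset_def tgt_def)
  then show ?thesis
    by (simp add: \<psi>)
qed

theorem corollary3p8p2:
  fixes Op :: "'o over_LF"
    and K :: "nat \<Rightarrow> 'u wcell \<Rightarrow> 'u kcell"
    and Sp :: "'s over_LF" and \<Theta> :: "nat \<Rightarrow> 's \<Rightarrow> 'u scell"
    and KK :: "nat \<Rightarrow> 'u wcell \<Rightarrow> 's"
  assumes "infty_operad Op"
    and "K_tensor K"
    and "smash_product Sp \<Theta>"
    and "connective_K_tensor Sp \<Theta> K KK"
  shows "postcompose Op K Wald_tensor \<in> smap (Alg Op Wald_tensor) (Alg Op Kan_tensor) \<and>
         postcompose Op KK Wald_tensor \<in> smap (Alg Op Wald_tensor) (Alg Op Sp)"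
proof -
  have "is_sset (tot Op)"
    using assms(1) by (simp add: infty_operad_def inner_fibration_def)
  \<comment> \<open>\<open>K_tensor K\<close> says that \<open>K\<close> is a value of
    \<open>D_tensor\<close> at \<open>iota_tensor\<close>.\<close>
  moreover have "operad_map Wald_tensor Kan_tensor K"
    using assms(2) D_tensor_multiplicative by (auto simp: K_tensor_def multiplicative_theory_def)
  moreover have "operad_map Wald_tensor Sp KK"
    using assms(4) by (simp add: connective_K_tensor_def)
  ultimately show ?thesis
    by (simp add: postcompose_smap)
qed

end
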